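(* Let $N\in\mathbb{N}$ and let $\eta\in C^\infty(\mathbb{S}^N)$ with $\eta>0$. Then $$\mathscr{P}^{\log}_{\eta g}(\varphi)=\eta^{-\frac N4}\,\mathscr{P}^{\log}_g(\eta^{\frac N4}\varphi)-\varphi\ln\eta\qquad\text{for any }\varphi\in C^\infty(\mathbb{S}^N).$$
   Context: $\mathbb{S}^N\subset\mathbb{R}^{N+1}$ is the unit sphere with round metric $g$ and volume element $dV_g$; $|z-\zeta|$ is the Euclidean distance in $\mathbb{R}^{N+1}$. For $s\in(0,1)$ the conformal fractional Laplacian of the round metric is $$\mathscr{P}^s_gu(z)=c_{N,s}\,\mathrm{P.V.}\int_{\mathbb{S}^N}\frac{u(z)-u(\zeta)}{|z-\zeta|^{N+2s}}\,dV_g(\zeta)+A_{N,s}u(z),$$ with $A_{N,s}=\frac{\Gamma(\frac N2+s)}{\Gamma(\frac N2-s)}$, $c_{N,s}=4^s\pi^{-N/2}\frac{\Gamma(\frac N2+s)}{\Gamma(2-s)}s(1-s)$. For a conformal metric $\eta g$, the conformal fractional Laplacian satisfies (and is determined by) the conformal law $$\mathscr{P}^s_{\eta g}(u)=\eta^{-\frac{N+2s}{4}}\mathscr{P}^s_g(\eta^{\frac{N-2s}{4}}u),\qquad u\in C^\infty(\mathbb{S}^N).$$ For each of the metrics $h=g$ and $h=\eta g$, the conformal logarithmic Laplacian is $\mathscr{P}^{\log}_hu:=\frac{d}{ds}\big|_{s=0}\mathscr{P}^s_hu=\lim_{s\to0^+}\frac{\mathscr{P}^s_hu-u}{s}$;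 for the round metric, $$\mathscr{P}^{\log}_gu(z)=c_N\int_{\mathbb{S}^N}\frac{u(z)-u(\zeta)}{|z-\zeta|^N}\,dV_g(\zeta)+A_Nu(z),$$ $c_N=\pi^{-N/2}\Gamma(\tfrac N2)$, $A_N=2\psi(\tfrac N2)$, $\psi=\Gamma'/\Gamma$. *)

theory Defs
  imports "HOL-Analysis.Analysis"
begin

text \<open>
  The sphere of dimension \<open>N\<close> is \<^term>\<open>sphere 0 1\<close> in a Euclidean space of dimension \<open>N + 1\<close>.
  A function on it is represented by a function on the ambient space; everything below depends
  only on the values on \<^term>\<open>sphere 0 1\<close>.
\<close>

primrec Ck_on :: "nat \<Rightarrow> 'a::euclidean_space set \<Rightarrow> ('a \<Rightarrow> real) \<Rightarrow> bool" where
  "Ck_on 0 U f \<longleftrightarrow> continuous_on U f"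
| "Ck_on (Suc k) U f \<longleftrightarrow>
     (\<forall>x\<in>U. f differentiable (at x)) \<and> (\<forall>v. Ck_on k U (\<lambda>x. frechet_derivative f (at x) v))"

text \<open>Smoothness on an embedded submanifold: locally the restriction of an ambient smooth function.\<close>

definition smooth_on_sphere :: "('a::euclidean_space \<Rightarrow> real) \<Rightarrow> bool" where
  "smooth_on_sphere u \<longleftrightarrow>
     (\<forall>z\<in>sphere 0 1. \<exists>U F. open U \<and> z \<in> U \<and> (\<forall>k. Ck_on k U F) \<and> (\<forall>x\<in>U \<inter> sphere 0 1. F x = u x))"

text \<open>
  The Riemannian volume of the round metric, as the measure in the polar decomposition of Lebesgue
  measure: the volume of \<open>A\<close> is \<open>N + 1\<close> times the Lebesgue measure of the cone over \<open>A\<close> with apex \<open>0\<close>,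
  since \<open>\<integral>\<^sub>0\<^sup>1 r\<^sup>N dr = 1 / (N + 1)\<close>.
\<close>

definition sphere_volume :: "'a::euclidean_space measure" where
  "sphere_volume =
     scale_measure (of_nat DIM('a))
       (distr (restrict_space lborel (cball 0 1 - {0})) (restrict_space borel (sphere 0 1))
         (\<lambda>x. x /\<^sub>R norm x))"

lemma space_sphere_volume [simp]: "space (sphere_volume :: 'a::euclidean_space measure) = sphere 0 1"
  by (simp add: sphere_volume_def space_scale_measure space_restrict_space)

lemma sets_sphere_volume [simp]:
  "sets (sphere_volume :: 'a::euclidean_space measure) = sets (restrict_space borel (sphere 0 1))"
  by (simp add: sphere_volume_def)

lemma emeasure_sphere_volume:
  fixes A :: "'a::euclidean_space set"
  assumes "A \<in> sets borel" "A \<subseteq> sphere 0 1"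
  shows "emeasure sphere_volume A =
    of_nat DIM('a) * emeasure lborel {t *\<^sub>R x | t x. 0 < t \<and> t \<le> 1 \<and> x \<in> A}"
proof -
  let ?f = "\<lambda>x::'a. x /\<^sub>R norm x"
  let ?C = "cball 0 1 - {0::'a}"
  have f: "?f \<in> restrict_space lborel ?C \<rightarrow>\<^sub>M restrict_space borel (sphere 0 1)"
    by (intro measurable_restrict_space2 measurable_restrict_space1) (auto simp: space_restrict_space)
  have A: "A \<in> sets (restrict_space borel (sphere 0 1))"
    using assms by (auto simp: sets_restrict_space)
  have cone: "?f -` A \<inter> ?C = {t *\<^sub>R x | t x. 0 < t \<and> t \<le> 1 \<and> x \<in> A}" (is "?L = ?R")
  proof (intro set_eqI iffI)
    fix y assume "y \<in> ?L"
    then have "y = norm y *\<^sub>R ?f y" "0 < norm y" "norm y \<le> 1" "?f y \<in> A" by auto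
    then show "y \<in> ?R" by blast
  next
    fix y assume "y \<in> ?R"
    then obtain t x where y: "y = t *\<^sub>R x" "0 < t" "t \<le> 1" "x \<in> A" by blast
    then have "norm x = 1" using assms by auto
    with y show "y \<in> ?L" by auto
  qed
  have "emeasure sphere_volume A =
      of_nat DIM('a) * emeasure (restrict_space lborel ?C) (?f -` A \<inter> ?C)"
    by (simp add: sphere_volume_def emeasure_distr[OF f A] space_restrict_space)
  also have "emeasure (restrict_space lborel ?C) (?f -` A \<inter> ?C) = emeasure lborel (?f -` A \<inter> ?C)"
    by (rule emeasure_restrict_space) auto
  finally show ?thesis by (simp add: cone)
qed

text \<open>The principal value removes geodesic balls about \<open>z\<close>, which are exactly the chordal balls.\<close>

definition pv_integral :: "'a::euclidean_space \<Rightarrow> ('a \<Rightarrow> real) \<Rightarrow> real" where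
  "pv_integral z f =
     Lim (at_right 0) (\<lambda>\<epsilon>. LINT \<zeta>:{\<zeta> \<in> sphere 0 1. \<epsilon> < dist z \<zeta>}|sphere_volume. f \<zeta>)"

definition c_const :: "nat \<Rightarrow> real \<Rightarrow> real" where
  "c_const N s =
     4 powr s * pi powr (- real N / 2) * (Gamma (real N / 2 + s) / Gamma (2 - s)) * s * (1 - s)"

definition A_const :: "nat \<Rightarrow> real \<Rightarrow> real" where
  "A_const N s = Gamma (real N / 2 + s) / Gamma (real N / 2 - s)"

definition round_frac_lap ::
  "nat \<Rightarrow> real \<Rightarrow> ('a::euclidean_space \<Rightarrow> real) \<Rightarrow> 'a \<Rightarrow> real" where
  "round_frac_lap N s u z =
     c_const N s * pv_integral z (\<lambda>\<zeta>. (u z - u \<zeta>) / dist z \<zeta> powr (real N + 2 * s))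
     + A_const N s * u z"

text \<open>For the metric \<open>\<eta> g\<close>, a metric being represented by its conformal factor \<open>\<eta>\<close> relative to the
  round metric \<open>g\<close>, the operator is determined by the conformal law.\<close>

definition conf_frac_lap ::
  "nat \<Rightarrow> ('a::euclidean_space \<Rightarrow> real) \<Rightarrow> real \<Rightarrow> ('a \<Rightarrow> real) \<Rightarrow> 'a \<Rightarrow> real" where
  "conf_frac_lap N \<eta> s u z =
     \<eta> z powr (- (real N + 2 * s) / 4)
     * round_frac_lap N s (\<lambda>\<zeta>. \<eta> \<zeta> powr ((real N - 2 * s) / 4) * u \<zeta>) z"

text \<open>
  The derivative at \<open>s = 0\<close> of a family \<open>P s\<close> of operators, \<open>0 < s < 1\<close>, extended by the identity at
  \<open>s = 0\<close>. The limit is pointwise; since \<^const>\<open>Lim\<close> is total, existence is a separate predicate.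
\<close>

definition has_log_lap ::
  "(real \<Rightarrow> ('a \<Rightarrow> real) \<Rightarrow> 'a \<Rightarrow> real) \<Rightarrow> ('a \<Rightarrow> real) \<Rightarrow> 'a \<Rightarrow> bool" where
  "has_log_lap P u z \<longleftrightarrow> (\<exists>l. ((\<lambda>s. (P s u z - u z) / s) \<longlongrightarrow> l) (at_right 0))"

definition log_lap ::
  "(real \<Rightarrow> ('a \<Rightarrow> real) \<Rightarrow> 'a \<Rightarrow> real) \<Rightarrow> ('a \<Rightarrow> real) \<Rightarrow> 'a \<Rightarrow> real" where
  "log_lap P u z = Lim (at_right 0) (\<lambda>s. (P s u z - u z) / s)"

end

theory Submission
  imports Defs
begin

text \<open>
  For small \<open>s\<close> the numerator of the singular integral is at most \<open>L |z - \<zeta>|\<close>, uniformly in \<open>s\<close>, so the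
  integrand is dominated by a multiple of \<open>|z - \<zeta>|\<close> to the power \<open>1/2 - N\<close>, which is integrable. Hence the
  principal value is an absolutely convergent integral and, by dominated convergence, its limit as
  \<open>s \<rightarrow> 0\<close> is the same for the weight \<open>\<eta>\<close> to the power \<open>(N - 2s)/4\<close> as for \<open>\<eta>\<close> to the power \<open>N/4\<close>.
  As \<open>c_const N s\<close> vanishes at \<open>0\<close>, varying the weights contributes nothing else there; in the
  zero-order term they multiply to \<open>\<eta>\<close> to the power \<open>-s\<close>, whose derivative at \<open>0\<close> is \<open>- ln \<eta>\<close>.
\<close>

section \<open>Limits as the parameter tends to 0 from the right\<close>

text \<open>The substitution of \<open>inverse t\<close> for \<open>t\<close> turns the limit at 0
  from the right into a limit at infinity, where dominated convergence for a real parameter applies.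
  It serves both the truncation radius and the order \<open>s\<close>.\<close>

lemma dominated_convergence_at_right_0:
  fixes f :: "real \<Rightarrow> 'b \<Rightarrow> real"
  assumes "g \<in> borel_measurable M" "\<And>t. f t \<in> borel_measurable M" "integrable M w"
    and lim: "\<And>x. x \<in> space M \<Longrightarrow> ((\<lambda>t. f t x) \<longlongrightarrow> g x) (at_right 0)"
    and bound: "eventually (\<lambda>t. \<forall>x\<in>space M. \<bar>f t x\<bar> \<le> w x) (at_right 0)"
  shows "((\<lambda>t. integral\<^sup>L M (f t)) \<longlongrightarrow> integral\<^sup>L M g) (at_right 0)"
proof -
  have "((\<lambda>t. integral\<^sup>L M (f (inverse t))) \<longlongrightarrow> integral\<^sup>L M g) at_top"
  proof (rule integral_dominated_convergence_at_top[where w = w])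
    show "AE x in M. ((\<lambda>t. f (inverse t) x) \<longlongrightarrow> g x) at_top"
      using lim by (auto simp: filterlim_at_right_to_top)
    show "\<forall>\<^sub>F t in at_top. AE x in M. norm (f (inverse t) x) \<le> w x"
      using bound unfolding at_right_to_top eventually_filtermap
      by (rule eventually_mono) (auto intro!: AE_I2)
  qed (use assms in auto)
  then show ?thesis by (simp add: filterlim_at_right_to_top)
qed

text \<open>Both Gamma factors are differentiable at \<open>N / 2 > 0\<close>. The value of the
  derivative can stay unspecified: it enters both sides of the final identity as
  \<open>A * \<phi> z\<close> and cancels.\<close>

lemma A_const_has_derivative_0:
  assumes "1 \<le> N"
  obtains A where "(A_const N has_real_derivative A) (at 0)"
proof -
  have "Gamma (real N / 2) > 0" using assms by (intro Gamma_real_pos) auto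
  moreover have "real N / 2 \<notin> \<int>\<^sub>\<le>\<^sub>0" using assms by (auto dest: nonpos_Ints_nonpos)
  ultimately show ?thesis
    using that unfolding A_const_def
    by (force intro!: derivative_eq_intros)
qed

text \<open>The explicit factor \<open>s\<close> of \<open>c_const N s\<close> cancels in the
  quotient; what remains is continuous at 0, where \<open>Gamma 2 = 1\<close>.\<close>

lemma c_const_tendsto_0:
  assumes "1 \<le> N"
  shows "((\<lambda>s. c_const N s / s) \<longlongrightarrow> pi powr (- real N / 2) * Gamma (real N / 2)) (at_right 0)"
proof -
  have [simp]: "real N / 2 \<notin> \<int>\<^sub>\<le>\<^sub>0" "(2::real) \<notin> \<int>\<^sub>\<le>\<^sub>0"
    using assms by (auto dest: nonpos_Ints_nonpos)
  have G2: "Gamma (2::real) = 1"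
    using Gamma_fact[of 1, where 'a = real] by simp
  have "((\<lambda>s. 4 powr s * pi powr (- real N / 2) * (Gamma (real N / 2 + s) / Gamma (2 - s)) * (1 - s))
      \<longlongrightarrow> 4 powr 0 * pi powr (- real N / 2) * (Gamma (real N / 2 + 0) / Gamma (2 - 0)) * (1 - 0))
    (at_right 0)"
    by (intro tendsto_intros) (auto simp: G2)
  then have "((\<lambda>s. 4 powr s * pi powr (- real N / 2) * (Gamma (real N / 2 + s) / Gamma (2 - s)) * (1 - s))
      \<longlongrightarrow> pi powr (- real N / 2) * Gamma (real N / 2)) (at_right 0)"
    by (simp add: G2)
  then show ?thesis
    by (rule Lim_transform_eventually)
      (rule eventually_mono[OF eventually_at_right_less], simp add: c_const_def)
qed

section \<open>Continuity and pointwise Lipschitz bounds of smooth functions\<close>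

lemma smooth_on_sphere_imp_continuous_on:
  assumes "smooth_on_sphere u"
  shows "continuous_on (sphere 0 1) u"
  unfolding continuous_on_eq_continuous_within
proof
  fix z :: 'a assume z: "z \<in> sphere 0 1"
  then obtain U F where U: "open U" "z \<in> U" "Ck_on 0 U F" "\<forall>x\<in>U \<inter> sphere 0 1. F x = u x"
    using assms unfolding smooth_on_sphere_def by metis
  then have "continuous (at z within sphere 0 1) F"
    by (auto simp: continuous_on_eq_continuous_at intro: continuous_at_imp_continuous_at_within)
  then have "(F \<longlongrightarrow> u z) (at z within sphere 0 1)"
    using U z by (simp add: continuous_within)
  then show "continuous (at z within sphere 0 1) u"
    unfolding continuous_within
    by (rule Lim_transform_eventually) (use U in \<open>force simp: eventually_at_topological\<close>)
qed

lemma continuous_on_sphere_bounded: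
  fixes u :: "'a::euclidean_space \<Rightarrow> real"
  assumes "continuous_on (sphere 0 1) u"
  obtains B where "0 \<le> B" "\<And>x. x \<in> sphere 0 1 \<Longrightarrow> \<bar>u x\<bar> \<le> B"
proof -
  have "bounded (u ` sphere 0 1)"
    using assms by (intro compact_imp_bounded compact_continuous_image) auto
  then obtain B where "\<forall>x\<in>sphere 0 1. \<bar>u x\<bar> \<le> B"
    by (auto simp: bounded_iff)
  then show ?thesis by (intro that[of "max 0 B"]) (auto simp: le_max_iff_disj)
qed

text \<open>Only the fixed base point \<open>z\<close> matters. Near it, differentiability of a
  local ambient extension gives the bound; at distance at least \<open>d\<close>, boundedness of
  \<open>u\<close> on the compact sphere does.\<close>

lemma smooth_on_sphere_lipschitz_at:
  fixes u :: "'a::euclidean_space \<Rightarrow> real"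
  assumes u: "smooth_on_sphere u" and z: "z \<in> sphere 0 1"
  obtains L where "0 \<le> L" "\<And>x. x \<in> sphere 0 1 \<Longrightarrow> \<bar>u z - u x\<bar> \<le> L * dist z x"
proof -
  obtain U F where U: "open U" "z \<in> U" "Ck_on (Suc 0) U F" "\<forall>x\<in>U \<inter> sphere 0 1. F x = u x"
    using u z unfolding smooth_on_sphere_def by metis
  then obtain F' where F': "(F has_derivative F') (at z)"
    by (auto simp: differentiable_def)
  obtain K where K: "0 < K" "\<And>h. norm (F' h) \<le> norm h * K"
    using bounded_linear.pos_bounded[OF has_derivative_bounded_linear[OF F']] by blast
  obtain d1 where d1: "0 < d1" "\<And>x. norm (x - z) < d1 \<Longrightarrow> norm (F x - F z - F' (x - z)) \<le> 1 * norm (x - z)"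
    using F' unfolding has_derivative_at_alt by (meson zero_less_one)
  obtain d2 where d2: "0 < d2" "ball z d2 \<subseteq> U"
    using U(1,2) by (meson open_contains_ball)
  define d where "d = min d1 d2"
  have d: "0 < d" using d1 d2 by (simp add: d_def)
  obtain B where B: "0 \<le> B" "\<And>x. x \<in> sphere 0 1 \<Longrightarrow> \<bar>u x\<bar> \<le> B"
    using continuous_on_sphere_bounded[OF smooth_on_sphere_imp_continuous_on[OF u]] by blast
  \<comment> \<open>\<open>K + 1\<close> is the bound on the derivative plus the remainder constant
    1, used within distance \<open>d\<close>; \<open>2 * B / d\<close> is used beyond it.\<close>
  define L where "L = max (K + 1) (2 * B / d)"
  show ?thesis
  proof (rule that[of L])
    show "0 \<le> L" using K by (simp add: L_def)
    fix x :: 'a assume x: "x \<in> sphere 0 1"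
    show "\<bar>u z - u x\<bar> \<le> L * dist z x"
    proof (cases "dist z x < d")
      case True
      then have "norm (F x - F z - F' (x - z)) \<le> norm (x - z)"
        using d1(2)[of x] by (simp add: d_def dist_norm norm_minus_commute)
      then have "\<bar>F z - F x\<bar> \<le> (K + 1) * dist z x"
        using K(2)[of "x - z"] by (simp add: dist_norm norm_minus_commute algebra_simps)
      moreover have "F z = u z" "F x = u x"
        using U True d2 x z by (auto simp: d_def subset_iff)
      moreover have "(K + 1) * dist z x \<le> L * dist z x"
        by (intro mult_right_mono) (auto simp: L_def)
      ultimately show ?thesis by simp
    next
      case False
      have "\<bar>u z - u x\<bar> \<le> 2 * B" using B(2)[OF x] B(2)[OF z] by linarith
      also have "\<dots> = 2 * B / d * d" using d by simp
      also have "\<dots> \<le> L * dist z x"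
        using False d B by (intro mult_mono) (auto simp: L_def le_max_iff_disj)
      finally show ?thesis .
    qed
  qed
qed

section \<open>Cap volumes and integrability of singular powers of the distance\<close>

text \<open>
  The cone over a cap of radius \<open>2h\<close> about \<open>z\<close> lies within \<open>2h\<close> of the segment from \<open>0\<close> to \<open>z\<close>, so about
  \<open>1/h\<close> balls of radius \<open>3h\<close> cover it.
\<close>

lemma emeasure_cap_le:
  fixes z :: "'a::euclidean_space"
  assumes z: "z \<in> sphere 0 1" and dim: "DIM('a) = N + 1"
  obtains K where "0 \<le> K"
    "\<And>k::nat. emeasure sphere_volume (sphere 0 1 \<inter> cball z (2 / 2 ^ k)) \<le> ennreal (K / (2 ^ k) ^ N)"
proof -
  define V where "V = unit_ball_vol (real (N + 1))"
  define K where "K = real (N + 1) * (2 * 3 ^ (N + 1) * V)"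
  have V: "0 \<le> V" by (simp add: V_def)
  show ?thesis
  proof (rule that[of K])
    show "0 \<le> K" using V by (simp add: K_def)
    fix k :: nat
    define h :: real where "h = 1 / 2 ^ k"
    have h: "0 < h" "2 ^ k * h = 1" by (auto simp: h_def)
    define A where "A = sphere 0 1 \<inter> cball z (2 / 2 ^ k)"
    define cone where "cone = {t *\<^sub>R x | t x. 0 < t \<and> t \<le> 1 \<and> x \<in> A}"
    \<comment> \<open>The centres are spaced by \<open>h\<close> along the segment. The radius is
      \<open>h\<close> for rounding \<open>t\<close> down to the grid plus \<open>2 * h\<close> for
      the size of the cap.\<close>
    define B where "B j = cball ((real j * h) *\<^sub>R z) (3 * h)" for j
    have "cone \<subseteq> (\<Union>j\<le>2 ^ k. B j)"
    proof
      fix y assume "y \<in> cone"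
      then obtain t x where y: "y = t *\<^sub>R x" "0 < t" "t \<le> 1" "x \<in> A"
        by (auto simp: cone_def)
      define j where "j = nat \<lfloor>t * 2 ^ k\<rfloor>"
      have j: "real j \<le> t * 2 ^ k" "t * 2 ^ k \<le> real j + 1"
        using y(2) by (auto simp: j_def)
      have "t * 2 ^ k \<le> 2 ^ k" using y(3) by simp
      then have "real j \<le> real (2 ^ k)" using j(1) by (simp only: of_nat_power of_nat_numeral)
      then have jle: "j \<le> 2 ^ k" by (simp only: of_nat_le_iff)
      have "real j * h \<le> (t * 2 ^ k) * h" "(t * 2 ^ k) * h \<le> (real j + 1) * h"
        using j h by (auto intro!: mult_right_mono)
      then have "\<bar>t - real j * h\<bar> \<le> h"
        unfolding mult.assoc h(2) by (simp add: algebra_simps abs_le_iff)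
      moreover have "t * norm (x - z) \<le> 1 * (2 * h)"
        using y by (intro mult_mono) (auto simp: A_def h_def dist_norm norm_minus_commute)
      moreover have "t *\<^sub>R x - (real j * h) *\<^sub>R z = t *\<^sub>R (x - z) + (t - real j * h) *\<^sub>R z"
        by (simp add: algebra_simps)
      then have "norm (t *\<^sub>R x - (real j * h) *\<^sub>R z) \<le> t * norm (x - z) + \<bar>t - real j * h\<bar>"
        using norm_triangle_ineq[of "t *\<^sub>R (x - z)" "(t - real j * h) *\<^sub>R z"] y z by simp
      ultimately have "norm (t *\<^sub>R x - (real j * h) *\<^sub>R z) \<le> 3 * h" by linarith
      then have "y \<in> B j" using y by (simp add: B_def dist_norm norm_minus_commute)
      then show "y \<in> (\<Union>j\<le>2 ^ k. B j)" using jle by blast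
    qed
    then have "emeasure lborel cone \<le> emeasure lborel (\<Union>j\<le>2 ^ k. B j)"
      by (rule emeasure_mono) (auto simp: B_def)
    also have "\<dots> \<le> (\<Sum>j\<le>2 ^ k. emeasure lborel (B j))"
      by (rule emeasure_subadditive_finite) (auto simp: B_def)
    also have "\<dots> = (\<Sum>j\<le>(2::nat) ^ k. ennreal (V * (3 * h) ^ (N + 1)))"
      using h by (intro sum.cong) (auto simp: B_def V_def emeasure_cball dim)
    also have "\<dots> = ennreal ((2 ^ k + 1) * (V * (3 * h) ^ (N + 1)))"
      using h V by (subst sum_ennreal) (auto simp: algebra_simps)
    also have "\<dots> \<le> ennreal ((2 * 2 ^ k) * (V * (3 * h) ^ (N + 1)))"
      using h V by (intro ennreal_leI mult_right_mono) auto
    \<comment> \<open>One of the \<open>N + 1\<close> factors \<open>h\<close> cancels against the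
      number of balls, which leaves the order \<open>h ^ N\<close>.\<close>
    also have "(2 * 2 ^ k) * (V * (3 * h) ^ (N + 1)) = 2 * 3 ^ (N + 1) * V * h ^ N * (2 ^ k * h)"
      by (simp add: power_mult_distrib)
    finally have cone: "emeasure lborel cone \<le> ennreal (2 * 3 ^ (N + 1) * V * h ^ N)"
      using h by simp
    have "emeasure sphere_volume A = of_nat DIM('a) * emeasure lborel cone"
      unfolding cone_def by (rule emeasure_sphere_volume) (auto simp: A_def)
    also have "\<dots> \<le> ennreal (real (N + 1)) * ennreal (2 * 3 ^ (N + 1) * V * h ^ N)"
      unfolding dim ennreal_of_nat_eq_real_of_nat by (intro mult_left_mono cone) auto
    also have "\<dots> = ennreal (K * h ^ N)"
      using h V by (subst ennreal_mult[symmetric]) (auto simp: K_def algebra_simps)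
    also have "K * h ^ N = K / (2 ^ k) ^ N"
      by (simp add: h_def power_one_over)
    finally show "emeasure sphere_volume (sphere 0 1 \<inter> cball z (2 / 2 ^ k)) \<le> ennreal (K / (2 ^ k) ^ N)"
      by (simp add: A_def)
  qed
qed

lemma borel_measurable_sphere_volume:
  fixes f :: "'a::euclidean_space \<Rightarrow> real"
  shows "f \<in> borel_measurable (restrict_space borel (sphere 0 1)) \<Longrightarrow> f \<in> borel_measurable sphere_volume"
  by (subst measurable_cong_sets[OF sets_sphere_volume refl])

text \<open>The least \<open>n\<close> with \<open>1 / 2 ^ n < d\<close> works: minimality gives the
  upper bound, and at \<open>k = 0\<close> that bound is the assumption
  \<open>d \<le> 2\<close>.\<close>

lemma dyadic_scale_obtain:
  fixes d :: real
  assumes "0 < d" "d \<le> 2"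
  obtains k :: nat where "1 / 2 ^ k < d" "d \<le> 2 / 2 ^ k"
proof -
  obtain n :: nat where "(1 / 2) ^ n < d"
    using real_arch_pow_inv[of d "1 / 2"] assms by auto
  then have ex: "\<exists>n::nat. 1 / 2 ^ n < d" by (auto simp: power_one_over)
  define k where "k = (LEAST n::nat. 1 / 2 ^ n < d)"
  have k: "1 / 2 ^ k < d" unfolding k_def using ex by (rule LeastI_ex)
  have "d \<le> 2 / 2 ^ k"
  proof (cases k)
    case (Suc j)
    then have "\<not> 1 / 2 ^ j < d" unfolding k_def using not_less_Least lessI by metis
    then show ?thesis using Suc by simp
  qed (use assms in auto)
  with k show ?thesis using that by blast
qed

text \<open>Dyadic decomposition about \<open>z\<close>: at scale \<open>k\<close> the power is at
  most \<open>c k\<close>, since the exponent is nonpositive, and the cap volume is of order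
  \<open>1 / (2 ^ k) ^ N\<close>. The product is a term of a geometric series with ratio
  \<open>2 powr (- a) < 1\<close>.\<close>

lemma integrable_dist_powr_sphere:
  fixes z :: "'a::euclidean_space"
  assumes z: "z \<in> sphere 0 1" and dim: "DIM('a) = N + 1" and a: "0 < a" "a \<le> real N"
  shows "integrable sphere_volume (\<lambda>x. dist z x powr (a - real N))"
proof (rule integrableI_nonneg)
  show "(\<lambda>x. dist z x powr (a - real N)) \<in> borel_measurable sphere_volume"
    by (intro borel_measurable_sphere_volume measurable_restrict_space1) measurable
  obtain K where K: "0 \<le> K"
    "\<And>k::nat. emeasure sphere_volume (sphere 0 1 \<inter> cball z (2 / 2 ^ k)) \<le> ennreal (K / (2 ^ k) ^ N)"
    using emeasure_cap_le[OF z dim] by blast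
  \<comment> \<open>Full caps replace dyadic shells: their overlap only enlarges the majorant, and
    the cap estimate applies to them directly.\<close>
  define C where "C k = sphere 0 1 \<inter> cball z (2 / 2 ^ k)" for k :: nat
  define c :: "nat \<Rightarrow> real" where "c k = (1 / 2 ^ k) powr (a - real N)" for k
  have C[measurable]: "C k \<in> sets sphere_volume" for k
    by (auto simp: C_def sets_restrict_space)
  have "(\<integral>\<^sup>+ x. ennreal (dist z x powr (a - real N)) \<partial>sphere_volume)
      \<le> (\<integral>\<^sup>+ x. (\<Sum>k. ennreal (c k) * indicator (C k) x) \<partial>sphere_volume)"
  proof (rule nn_integral_mono)
    fix x :: 'a assume "x \<in> space sphere_volume"
    then have x: "x \<in> sphere 0 1" by simp
    show "ennreal (dist z x powr (a - real N)) \<le> (\<Sum>k. ennreal (c k) * indicator (C k) x)"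
    \<comment> \<open>At \<open>x = z\<close> the left side is 0, because
      \<open>0 powr p = 0\<close> for every \<open>p\<close>.\<close>
    proof (cases "x = z")
      case False
      have "dist z x \<le> dist z 0 + dist 0 x" by (rule dist_triangle)
      then have "dist z x \<le> 2" using x z by (simp add: dist_commute)
      then obtain k where k: "1 / 2 ^ k < dist z x" "dist z x \<le> 2 / 2 ^ k"
        using False dyadic_scale_obtain[of "dist z x"] by auto
      have "dist z x powr (a - real N) \<le> c k"
        unfolding c_def using a k by (intro powr_mono2') auto
      then have "ennreal (dist z x powr (a - real N)) \<le> ennreal (c k) * indicator (C k) x"
        using x k by (simp add: C_def ennreal_leI)
      also have "\<dots> \<le> (\<Sum>k. ennreal (c k) * indicator (C k) x)"
        using sum_le_suminf[of "\<lambda>k. ennreal (c k) * indicator (C k) x" "{k}"]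
        by (simp only: sum.insert finite.emptyI empty_iff not_False_eq_True sum.empty add_0_right) simp
      finally show ?thesis .
    qed simp
  qed
  also have "\<dots> = (\<Sum>k. ennreal (c k) * emeasure sphere_volume (C k))"
    by (subst nn_integral_suminf) (simp_all only: nn_integral_cmult_indicator[OF C], measurable)
  also have "\<dots> \<le> (\<Sum>k. ennreal (K * (2 powr (- a)) ^ k))"
  proof (rule suminf_le)
    fix k
    have "ennreal (c k) * emeasure sphere_volume (C k) \<le> ennreal (c k) * ennreal (K / (2 ^ k) ^ N)"
      using K by (intro mult_left_mono) (auto simp: C_def)
    also have "\<dots> = ennreal (c k * (K / (2 ^ k) ^ N))"
      using K by (subst ennreal_mult) (auto simp: c_def)
    also have "c k * (K / (2 ^ k) ^ N) = K * (2 powr (- a)) ^ k"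
    proof -
      have "c k = 2 powr (real k * (real N - a))"
        by (simp add: c_def powr_realpow[symmetric] powr_minus_divide[symmetric] powr_powr
            algebra_simps del: powr_minus_divide)
      moreover have "(2 ^ k) ^ N = (2::real) powr (real k * real N)"
        by (simp add: powr_realpow[symmetric] powr_powr flip: power_mult)
      moreover have "(2 powr (- a)) ^ k = (2::real) powr (- (real k * a))"
        by (simp add: powr_power mult.commute)
      ultimately show ?thesis
        by (simp add: right_diff_distrib powr_diff powr_minus field_simps)
    qed
    finally show "ennreal (c k) * emeasure sphere_volume (C k) \<le> ennreal (K * (2 powr (- a)) ^ k)" .
  qed auto
  also have "\<dots> < \<infinity>"
  proof -
    have "(2::real) powr (- a) < 2 powr 0" using a by (intro powr_less_mono) auto
    then have "summable (\<lambda>k. K * (2 powr (- a)) ^ k)"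
      by (intro summable_mult summable_geometric) auto
    then show ?thesis
      using K by (simp add: ennreal_suminf_neq_top less_top)
  qed
  finally show "(\<integral>\<^sup>+ x. ennreal (dist z x powr (a - real N)) \<partial>sphere_volume) < \<infinity>" .
qed auto

section \<open>Principal values as convergent integrals, and their limit in the order\<close>

text \<open>The truncated integrands are dominated by \<open>g\<close> and converge to
  \<open>f\<close> pointwise. Every truncation with positive radius discards \<open>z\<close>, so
  convergence at \<open>z\<close> itself rests on \<open>f z = 0\<close>.\<close>

lemma pv_integral_eq_lebesgue_integral:
  fixes f :: "'a::euclidean_space \<Rightarrow> real"
  assumes f[measurable]: "f \<in> borel_measurable sphere_volume" and g: "integrable sphere_volume g"
    and bound: "\<And>x. x \<in> sphere 0 1 \<Longrightarrow> \<bar>f x\<bar> \<le> g x" and fz: "f z = 0"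
  shows "pv_integral z f = (LINT x|sphere_volume. f x)"
proof -
  have sets[measurable]: "{x \<in> sphere 0 1. \<epsilon> < dist z x} \<in> sets sphere_volume" for \<epsilon>
  proof -
    have "{x \<in> sphere 0 1. \<epsilon> < dist z x} = sphere 0 1 \<inter> {x. \<epsilon> < dist z x}" by auto
    moreover have "{x. \<epsilon> < dist z x} \<in> sets borel" by measurable
    ultimately show ?thesis by (auto simp: sets_restrict_space)
  qed
  have "((\<lambda>\<epsilon>. LINT x:{x \<in> sphere 0 1. \<epsilon> < dist z x}|sphere_volume. f x)
      \<longlongrightarrow> (LINT x|sphere_volume. f x)) (at_right 0)"
    unfolding set_lebesgue_integral_def
  proof (rule dominated_convergence_at_right_0[where w = g])
    fix x :: 'a assume "x \<in> space sphere_volume"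
    then have x: "x \<in> sphere 0 1" by simp
    show "((\<lambda>\<epsilon>. indicat_real {x \<in> sphere 0 1. \<epsilon> < dist z x} x *\<^sub>R f x) \<longlongrightarrow> f x) (at_right 0)"
    proof (cases "x = z")
      case False
      then have "eventually (\<lambda>\<epsilon>. \<epsilon> < dist z x) (at_right 0)"
        by (intro eventually_mono[OF eventually_at_right_real[of 0 "dist z x"]]) auto
      then show ?thesis
        by (intro tendsto_eventually, elim eventually_mono) (use x in auto)
    qed (use fz in simp)
  next
    show "eventually (\<lambda>\<epsilon>. \<forall>x\<in>space sphere_volume.
        \<bar>indicat_real {x \<in> sphere 0 1. \<epsilon> < dist z x} x *\<^sub>R f x\<bar> \<le> g x) (at_right 0)"
      using bound by (intro always_eventually) (force simp: indicator_def)
  qed (use g in measurable)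
  then show ?thesis
    unfolding pv_integral_def by (intro tendsto_Lim) auto
qed

text \<open>A family \<open>w s\<close> is allowed so that both operators are covered: a family
  constant in \<open>s\<close> for the round metric, and one with weight exponent
  \<open>(N - 2 * s) / 4\<close> for the conformal metric.\<close>

lemma pv_integral_tendsto:
  fixes w :: "real \<Rightarrow> 'a::euclidean_space \<Rightarrow> real"
  assumes z: "z \<in> sphere 0 1" and dim: "DIM('a) = N + 1" and N: "1 \<le> N"
    and cont: "\<And>s. continuous_on (sphere 0 1) (w s)"
    and lim: "\<And>x. x \<in> sphere 0 1 \<Longrightarrow> ((\<lambda>s. w s x) \<longlongrightarrow> w 0 x) (at_right 0)"
    and bound: "\<And>s x. 0 < s \<Longrightarrow> s \<le> 1 / 4 \<Longrightarrow> x \<in> sphere 0 1 \<Longrightarrow> \<bar>w s z - w s x\<bar> \<le> L * dist z x"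
  shows "((\<lambda>s. pv_integral z (\<lambda>x. (w s z - w s x) / dist z x powr (real N + 2 * s)))
    \<longlongrightarrow> (LINT x|sphere_volume. (w 0 z - w 0 x) / dist z x powr real N)) (at_right 0)"
proof -
  define f where "f s x = (w s z - w s x) / dist z x powr (real N + 2 * s)" for s x
  \<comment> \<open>With \<open>d = dist z x\<close>, the integrand is at most \<open>L\<close>
    times \<open>d powr (1 / 2 - 2 * s) * d powr (1 / 2 - N)\<close>. For
    \<open>0 < s \<le> 1 / 4\<close> the first exponent lies between 0 and 1, and
    \<open>d \<le> 2\<close>, whence the factor 2.\<close>
  define g where "g x = 2 * L * dist z x powr (1 / 2 - real N)" for x
  have f: "f s \<in> borel_measurable sphere_volume" for s
  proof (rule borel_measurable_sphere_volume)
    have [measurable]: "w s \<in> borel_measurable (restrict_space borel (sphere 0 1))"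
      by (rule borel_measurable_continuous_on_restrict[OF cont])
    have [measurable]: "dist z \<in> borel_measurable (restrict_space borel (sphere 0 1))"
      by (rule measurable_restrict_space1) measurable
    show "f s \<in> borel_measurable (restrict_space borel (sphere 0 1))"
      unfolding f_def by measurable
  qed
  have g: "integrable sphere_volume g"
    unfolding g_def using integrable_dist_powr_sphere[OF z dim, of "1 / 2"] N by simp
  have fg: "\<bar>f s x\<bar> \<le> g x" if s: "0 < s" "s \<le> 1 / 4" and x: "x \<in> sphere 0 1" for s x
  proof (cases "x = z")
    case False
    define d where "d = dist z x"
    have d: "0 < d" using False by (simp add: d_def)
    have "dist z x \<le> dist z 0 + dist 0 x" by (rule dist_triangle)
    then have d2: "d \<le> 2" using x z by (simp add: dist_commute d_def)
    \<comment> \<open>The sign of \<open>L\<close> is read off from the Lipschitz bound itself at a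
      point other than \<open>z\<close>.\<close>
    have L: "0 \<le> L * d" using bound[OF s x] unfolding d_def by linarith
    then have L: "0 \<le> L" using d by (simp add: zero_le_mult_iff)
    have "d powr (1 / 2 - 2 * s) \<le> 2 powr (1 / 2 - 2 * s)"
      using d d2 s by (intro powr_mono2) auto
    also have "\<dots> \<le> 2 powr 1" using s by (intro powr_mono) auto
    finally have e: "d powr (1 / 2 - 2 * s) \<le> 2" by simp
    have "\<bar>f s x\<bar> \<le> L * d / d powr (real N + 2 * s)"
      using bound[OF s x] by (simp add: f_def d_def divide_right_mono)
    also have "\<dots> = L * (d powr 1 / d powr (real N + 2 * s))" using d by simp
    also have "\<dots> = L * (d powr (1 / 2 - 2 * s) * d powr (1 / 2 - real N))"
      unfolding powr_diff[symmetric] powr_add[symmetric] by (simp add: algebra_simps)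
    also have "\<dots> \<le> L * (2 * d powr (1 / 2 - real N))"
      using L e by (intro mult_left_mono mult_right_mono) auto
    finally show ?thesis by (simp add: g_def d_def)
  qed (simp add: f_def g_def)
  have ev: "eventually (\<lambda>s::real. 0 < s \<and> s \<le> 1 / 4) (at_right 0)"
    using eventually_at_right_real[of 0 "1 / 4"] by (auto elim!: eventually_mono)
  have "((\<lambda>s. integral\<^sup>L sphere_volume (f s)) \<longlongrightarrow> integral\<^sup>L sphere_volume (f 0)) (at_right 0)"
  proof (rule dominated_convergence_at_right_0[where w = g])
    fix x :: 'a assume "x \<in> space sphere_volume"
    then have x: "x \<in> sphere 0 1" by simp
    show "((\<lambda>s. f s x) \<longlongrightarrow> f 0 x) (at_right 0)"
    proof (cases "x = z")
      case False
      have "((\<lambda>s. f s x) \<longlongrightarrow> (w 0 z - w 0 x) / dist z x powr (real N + 2 * 0)) (at_right 0)"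
        unfolding f_def using False by (intro tendsto_intros lim x z) auto
      then show ?thesis by (simp add: f_def)
    qed (simp add: f_def)
  next
    show "eventually (\<lambda>s. \<forall>x\<in>space sphere_volume. \<bar>f s x\<bar> \<le> g x) (at_right 0)"
      using ev by (rule eventually_mono) (use fg in auto)
  qed (use f g in auto)
  moreover have "eventually (\<lambda>s. integral\<^sup>L sphere_volume (f s) = pv_integral z (f s)) (at_right 0)"
    using ev
  proof (rule eventually_mono)
    fix s :: real assume s: "0 < s \<and> s \<le> 1 / 4"
    show "integral\<^sup>L sphere_volume (f s) = pv_integral z (f s)"
      using s fg by (intro pv_integral_eq_lebesgue_integral[OF f g, symmetric]) (auto simp: f_def)
  qed
  ultimately have "((\<lambda>s. pv_integral z (f s)) \<longlongrightarrow> integral\<^sup>L sphere_volume (f 0)) (at_right 0)"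
    by (rule Lim_transform_eventually)
  then show ?thesis by (simp add: f_def[abs_def])
qed

section \<open>Lipschitz bounds uniform in the exponent of the weight\<close>

text \<open>The tangent inequality \<open>exp (y - x) \<ge> 1 + (y - x)\<close>, multiplied by
  \<open>exp x\<close>, replaces the mean value theorem. It transfers bounds on
  \<open>p * ln (\<eta> x)\<close> to \<open>\<eta> x powr p\<close>.\<close>

lemma abs_exp_diff_le:
  fixes a b :: real
  assumes "a \<le> M" "b \<le> M"
  shows "\<bar>exp a - exp b\<bar> \<le> exp M * \<bar>a - b\<bar>"
proof -
  have *: "exp x - exp y \<le> exp M * (x - y)" if "y \<le> x" "x \<le> M" for x y :: real
  proof -
    have "exp x * (1 - exp (y - x)) \<le> exp x * (x - y)"
      using exp_ge_add_one_self[of "y - x"] by (intro mult_left_mono) (linarith, simp)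
    also have "\<dots> \<le> exp M * (x - y)" using that by (intro mult_right_mono) auto
    finally show ?thesis by (simp add: algebra_simps flip: exp_add)
  qed
  show ?thesis
    using *[of a b] *[of b a] assms by (cases "a \<le> b") (auto simp: abs_if)
qed

text \<open>The point is that a single \<open>L\<close> serves all exponents \<open>p\<close>, which
  later vary with \<open>s\<close>. On the compact sphere \<open>1 / \<eta>\<close> is bounded, so
  \<open>ln \<eta>\<close> inherits the Lipschitz bound of \<open>\<eta>\<close> at
  \<open>z\<close>; exponentiating \<open>p * ln \<eta>\<close> and splitting the product with
  \<open>\<phi>\<close> finishes.\<close>

lemma weighted_lipschitz_at:
  fixes \<eta> \<phi> :: "'a::euclidean_space \<Rightarrow> real"
  assumes \<eta>: "smooth_on_sphere \<eta>" "\<forall>x\<in>sphere 0 1. 0 < \<eta> x" and \<phi>: "smooth_on_sphere \<phi>"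
    and z: "z \<in> sphere 0 1"
  obtains L where "\<And>p x. \<bar>p\<bar> \<le> P \<Longrightarrow> x \<in> sphere 0 1 \<Longrightarrow>
    \<bar>\<eta> z powr p * \<phi> z - \<eta> x powr p * \<phi> x\<bar> \<le> L * dist z x"
proof (cases "0 \<le> P")
  case P: True
  have c: "continuous_on (sphere 0 1) (\<lambda>x. ln (\<eta> x))" "continuous_on (sphere 0 1) (\<lambda>x. 1 / \<eta> x)"
    using smooth_on_sphere_imp_continuous_on[OF \<eta>(1)] \<eta>(2)
    by (auto intro!: continuous_intros)
  obtain M where M: "0 \<le> M" "\<And>x. x \<in> sphere 0 1 \<Longrightarrow> \<bar>ln (\<eta> x)\<bar> \<le> M"
    using continuous_on_sphere_bounded[OF c(1)] by blast
  obtain R where R: "0 \<le> R" "\<And>x. x \<in> sphere 0 1 \<Longrightarrow> \<bar>1 / \<eta> x\<bar> \<le> R"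
    using continuous_on_sphere_bounded[OF c(2)] by blast
  obtain B where B: "0 \<le> B" "\<And>x. x \<in> sphere 0 1 \<Longrightarrow> \<bar>\<phi> x\<bar> \<le> B"
    using continuous_on_sphere_bounded[OF smooth_on_sphere_imp_continuous_on[OF \<phi>]] by blast
  obtain L1 where L1: "0 \<le> L1" "\<And>x. x \<in> sphere 0 1 \<Longrightarrow> \<bar>\<eta> z - \<eta> x\<bar> \<le> L1 * dist z x"
    using smooth_on_sphere_lipschitz_at[OF \<eta>(1) z] by blast
  obtain L2 where L2: "0 \<le> L2" "\<And>x. x \<in> sphere 0 1 \<Longrightarrow> \<bar>\<phi> z - \<phi> x\<bar> \<le> L2 * dist z x"
    using smooth_on_sphere_lipschitz_at[OF \<phi> z] by blast
  have ln: "\<bar>ln (\<eta> z) - ln (\<eta> x)\<bar> \<le> R * (L1 * dist z x)" if x: "x \<in> sphere 0 1" for x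
  proof -
    have *: "ln (\<eta> u) - ln (\<eta> v) \<le> R * \<bar>\<eta> u - \<eta> v\<bar>" if "u \<in> sphere 0 1" "v \<in> sphere 0 1" for u v
    proof -
      have uv: "0 < \<eta> u" "0 < \<eta> v" using \<eta>(2) that by auto
      have "ln (\<eta> u) - ln (\<eta> v) \<le> (\<eta> u - \<eta> v) / \<eta> v" by (rule ln_diff_le[OF uv])
      also have "\<dots> \<le> \<bar>1 / \<eta> v\<bar> * \<bar>\<eta> u - \<eta> v\<bar>"
        using uv by (simp add: divide_right_mono)
      also have "\<dots> \<le> R * \<bar>\<eta> u - \<eta> v\<bar>" using R that by (intro mult_right_mono) auto
      finally show ?thesis .
    qed
    have "\<bar>ln (\<eta> z) - ln (\<eta> x)\<bar> \<le> R * \<bar>\<eta> z - \<eta> x\<bar>"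
      using *[OF x z] *[OF z x] by (simp add: abs_le_iff abs_minus_commute)
    also have "\<dots> \<le> R * (L1 * dist z x)" using R L1 x by (intro mult_left_mono) auto
    finally show ?thesis .
  qed
  show ?thesis
  \<comment> \<open>The first summand is the variation of \<open>\<phi>\<close> against a weight of
    at most \<open>exp (P * M)\<close>; the second is the variation of the weight against the bound
    \<open>B\<close> of \<open>\<phi>\<close>.\<close>
  proof (rule that[of "exp (P * M) * L2 + B * (exp (P * M) * (P * (R * L1)))"])
    fix p and x :: 'a assume p: "\<bar>p\<bar> \<le> P" and x: "x \<in> sphere 0 1"
    have e: "\<eta> y powr p = exp (p * ln (\<eta> y))" "p * ln (\<eta> y) \<le> P * M" if "y \<in> sphere 0 1" for y
    proof -
      show "\<eta> y powr p = exp (p * ln (\<eta> y))" using \<eta>(2) that by (force simp: powr_def)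
      have "p * ln (\<eta> y) \<le> \<bar>p\<bar> * \<bar>ln (\<eta> y)\<bar>" by (metis abs_ge_self abs_mult)
      also have "\<dots> \<le> P * M" using p M P that by (intro mult_mono) auto
      finally show "p * ln (\<eta> y) \<le> P * M" .
    qed
    have "\<bar>\<eta> z powr p - \<eta> x powr p\<bar> \<le> exp (P * M) * \<bar>p * ln (\<eta> z) - p * ln (\<eta> x)\<bar>"
      using e x z by (simp add: abs_exp_diff_le)
    also have "\<dots> = exp (P * M) * (\<bar>p\<bar> * \<bar>ln (\<eta> z) - ln (\<eta> x)\<bar>)"
      by (simp add: abs_mult flip: right_diff_distrib)
    also have "\<dots> \<le> exp (P * M) * (P * (R * (L1 * dist z x)))"
      using p P ln[OF x] by (intro mult_left_mono mult_mono) auto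
    finally have d: "\<bar>\<eta> z powr p - \<eta> x powr p\<bar> \<le> exp (P * M) * (P * (R * (L1 * dist z x)))" .
    have "\<bar>\<eta> z powr p * \<phi> z - \<eta> x powr p * \<phi> x\<bar>
        = \<bar>\<eta> z powr p * (\<phi> z - \<phi> x) + \<phi> x * (\<eta> z powr p - \<eta> x powr p)\<bar>"
      by (simp add: algebra_simps)
    also have "\<dots> \<le> \<bar>\<eta> z powr p\<bar> * \<bar>\<phi> z - \<phi> x\<bar> + \<bar>\<phi> x\<bar> * \<bar>\<eta> z powr p - \<eta> x powr p\<bar>"
      unfolding abs_mult[symmetric] by (rule abs_triangle_ineq)
    also have "\<dots> \<le> exp (P * M) * (L2 * dist z x) + B * (exp (P * M) * (P * (R * (L1 * dist z x))))"
      using e z L2(2)[OF x] B(1) B(2)[OF x] d by (intro add_mono mult_mono) auto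
    finally show "\<bar>\<eta> z powr p * \<phi> z - \<eta> x powr p * \<phi> x\<bar>
        \<le> (exp (P * M) * L2 + B * (exp (P * M) * (P * (R * L1)))) * dist z x"
      by (simp add: algebra_simps)
  qed
qed (use that in force)

section \<open>Differentiation of the conformal law at order zero\<close>

theorem proposition1p6:
  fixes N :: nat and \<eta> :: "'a::euclidean_space \<Rightarrow> real"
  assumes "1 \<le> N" and "DIM('a) = N + 1"
    and "smooth_on_sphere \<eta>" and "\<forall>z\<in>sphere 0 1. 0 < \<eta> z"
  shows "\<forall>\<phi>. smooth_on_sphere \<phi> \<longrightarrow> (\<forall>z\<in>sphere 0 1.
    has_log_lap (round_frac_lap N) (\<lambda>\<zeta>. \<eta> \<zeta> powr (real N / 4) * \<phi> \<zeta>) z \<and>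
    has_log_lap (conf_frac_lap N \<eta>) \<phi> z \<and>
    log_lap (conf_frac_lap N \<eta>) \<phi> z =
      \<eta> z powr (- real N / 4)
        * log_lap (round_frac_lap N) (\<lambda>\<zeta>. \<eta> \<zeta> powr (real N / 4) * \<phi> \<zeta>) z
      - \<phi> z * ln (\<eta> z))"
proof (intro allI impI ballI)
  fix \<phi> :: "'a \<Rightarrow> real" and z :: 'a
  assume \<phi>: "smooth_on_sphere \<phi>" and z: "z \<in> sphere 0 1"
  have \<eta>z: "0 < \<eta> z" using assms(4) z by blast
  obtain A where A: "(A_const N has_real_derivative A) (at 0)"
    using A_const_has_derivative_0[OF assms(1)] by blast
  have "Gamma (real N / 2) > 0" using assms(1) by (intro Gamma_real_pos) auto
  then have A0: "A_const N 0 = 1" by (simp add: A_const_def)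
  define c where "c = pi powr (- real N / 2) * Gamma (real N / 2)"
  have c: "((\<lambda>s. c_const N s / s) \<longlongrightarrow> c) (at_right 0)"
    unfolding c_def by (rule c_const_tendsto_0[OF assms(1)])
  define v where "v x = \<eta> x powr (real N / 4) * \<phi> x" for x
  define w where "w s x = \<eta> x powr ((real N - 2 * s) / 4) * \<phi> x" for s x
  have w0: "w 0 = v" by (simp add: w_def v_def fun_eq_iff)
  define I where "I = (LINT x|sphere_volume. (v z - v x) / dist z x powr real N)"
  \<comment> \<open>This range contains the exponent \<open>N / 4\<close> of \<open>v\<close> and,
    for \<open>0 < s \<le> 1 / 4\<close>, the exponent \<open>(N - 2 * s) / 4\<close> of
    \<open>w s\<close>, which is positive as \<open>N \<ge> 1\<close>.\<close>
  obtain L where L: "\<And>p x. \<bar>p\<bar> \<le> real N / 4 \<Longrightarrow> x \<in> sphere 0 1 \<Longrightarrow>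
    \<bar>\<eta> z powr p * \<phi> z - \<eta> x powr p * \<phi> x\<bar> \<le> L * dist z x"
    using weighted_lipschitz_at[OF assms(3,4) \<phi> z] by blast
  have cont_w: "continuous_on (sphere 0 1) (w s)" for s
    unfolding w_def using assms(4) smooth_on_sphere_imp_continuous_on[OF assms(3)]
      smooth_on_sphere_imp_continuous_on[OF \<phi>]
    by (intro continuous_intros) auto
  have Iv: "((\<lambda>s. pv_integral z (\<lambda>x. (v z - v x) / dist z x powr (real N + 2 * s)))
      \<longlongrightarrow> I) (at_right 0)"
    unfolding I_def
    by (rule pv_integral_tendsto[OF z assms(2,1), where w = "\<lambda>_. v" and L = L])
      (use cont_w[of 0] w0 L in \<open>auto simp: v_def\<close>)
  have lim_w: "((\<lambda>s. w s x) \<longlongrightarrow> w 0 x) (at_right 0)" if "x \<in> sphere 0 1" for x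
    unfolding w_def using assms(4) that by (intro tendsto_intros) force+
  have Iw: "((\<lambda>s. pv_integral z (\<lambda>x. (w s z - w s x) / dist z x powr (real N + 2 * s)))
      \<longlongrightarrow> I) (at_right 0)"
    unfolding I_def w0[symmetric]
  proof (rule pv_integral_tendsto[OF z assms(2,1) cont_w lim_w])
    fix s :: real and x :: 'a
    assume "0 < s" "s \<le> 1 / 4" "x \<in> sphere 0 1"
    then show "\<bar>w s z - w s x\<bar> \<le> L * dist z x"
      unfolding w_def using assms(1) by (intro L) auto
  qed
  \<comment> \<open>Since \<open>A_const N 0 = 1\<close>, subtracting the identity operator turns
    the zero-order coefficient into a difference quotient at 0.\<close>
  have "((\<lambda>s. (A_const N s - 1) / s) \<longlongrightarrow> A) (at_right 0)"
    using A unfolding has_field_derivative_iff by (simp add: A0 filterlim_at_split)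
  then have "((\<lambda>s. c_const N s / s * pv_integral z (\<lambda>x. (v z - v x) / dist z x powr (real N + 2 * s))
      + (A_const N s - 1) / s * v z) \<longlongrightarrow> c * I + A * v z) (at_right 0)"
    by (intro tendsto_intros c Iv)
  then have round: "((\<lambda>s. (round_frac_lap N s v z - v z) / s) \<longlongrightarrow> c * I + A * v z) (at_right 0)"
    by (simp add: round_frac_lap_def add_divide_distrib diff_divide_distrib algebra_simps)
  have "((\<lambda>s. A_const N s * \<eta> z powr (- s)) has_real_derivative A - ln (\<eta> z)) (at 0)"
    using A \<eta>z by (auto intro!: derivative_eq_intros simp: A0)
  then have "((\<lambda>s. (A_const N s * \<eta> z powr (- s) - 1) / s) \<longlongrightarrow> A - ln (\<eta> z)) (at_right 0)"
    using \<eta>z unfolding has_field_derivative_iff by (simp add: A0 filterlim_at_split)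
  then have "((\<lambda>s. \<eta> z powr (- (real N + 2 * s) / 4) * (c_const N s / s
        * pv_integral z (\<lambda>x. (w s z - w s x) / dist z x powr (real N + 2 * s)))
      + (A_const N s * \<eta> z powr (- s) - 1) / s * \<phi> z)
      \<longlongrightarrow> \<eta> z powr (- (real N + 2 * 0) / 4) * (c * I) + (A - ln (\<eta> z)) * \<phi> z) (at_right 0)"
    using \<eta>z by (intro tendsto_intros c Iw) auto
  \<comment> \<open>This holds for every \<open>s\<close>: at \<open>s = 0\<close> both sides are 0,
    as division by zero yields 0.\<close>
  moreover have "(conf_frac_lap N \<eta> s \<phi> z - \<phi> z) / s =
      \<eta> z powr (- (real N + 2 * s) / 4) * (c_const N s / s
        * pv_integral z (\<lambda>x. (w s z - w s x) / dist z x powr (real N + 2 * s)))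
      + (A_const N s * \<eta> z powr (- s) - 1) / s * \<phi> z" for s
  proof -
    have "\<eta> z powr (- (real N + 2 * s) / 4) * w s z = \<eta> z powr (- s) * \<phi> z"
      unfolding w_def mult.assoc[symmetric] powr_add[symmetric] by (simp add: field_simps)
    moreover have "conf_frac_lap N \<eta> s \<phi> z = \<eta> z powr (- (real N + 2 * s) / 4) * (c_const N s
        * pv_integral z (\<lambda>x. (w s z - w s x) / dist z x powr (real N + 2 * s)))
        + A_const N s * (\<eta> z powr (- (real N + 2 * s) / 4) * w s z)"
      unfolding conf_frac_lap_def round_frac_lap_def w_def by (simp add: algebra_simps)
    ultimately show ?thesis
      by (simp add: add_divide_distrib diff_divide_distrib algebra_simps)
  qed
  ultimately have conf: "((\<lambda>s. (conf_frac_lap N \<eta> s \<phi> z - \<phi> z) / s)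
      \<longlongrightarrow> \<eta> z powr (- real N / 4) * (c * I) + (A - ln (\<eta> z)) * \<phi> z) (at_right 0)"
    by simp
  \<comment> \<open>The outer weight undoes that of \<open>v z\<close>, so both sides carry the same
    \<open>A * \<phi> z\<close> and differ only by the logarithmic term.\<close>
  have "\<eta> z powr (- real N / 4) * v z = \<phi> z"
    unfolding v_def mult.assoc[symmetric] powr_add[symmetric] using \<eta>z by simp
  then have "\<eta> z powr (- real N / 4) * (c * I + A * v z) = \<eta> z powr (- real N / 4) * (c * I) + A * \<phi> z"
    by (simp only: distrib_left mult.left_commute[of _ A])
  moreover have "log_lap (round_frac_lap N) v z = c * I + A * v z"
    unfolding log_lap_def by (rule tendsto_Lim[OF _ round]) simp
  moreover have "log_lap (conf_frac_lap N \<eta>) \<phi> z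
      = \<eta> z powr (- real N / 4) * (c * I) + (A - ln (\<eta> z)) * \<phi> z"
    unfolding log_lap_def by (rule tendsto_Lim[OF _ conf]) simp
  ultimately have "log_lap (conf_frac_lap N \<eta>) \<phi> z =
      \<eta> z powr (- real N / 4) * log_lap (round_frac_lap N) v z - \<phi> z * ln (\<eta> z)"
    by (simp only: left_diff_distrib) simp
  moreover have "has_log_lap (round_frac_lap N) v z" "has_log_lap (conf_frac_lap N \<eta>) \<phi> z"
    unfolding has_log_lap_def using round conf by blast+
  ultimately show "has_log_lap (round_frac_lap N) (\<lambda>\<zeta>. \<eta> \<zeta> powr (real N / 4) * \<phi> \<zeta>) z \<and>
    has_log_lap (conf_frac_lap N \<eta>) \<phi> z \<and>
    log_lap (conf_frac_lap N \<eta>) \<phi> z =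
      \<eta> z powr (- real N / 4)
        * log_lap (round_frac_lap N) (\<lambda>\<zeta>. \<eta> \<zeta> powr (real N / 4) * \<phi> \<zeta>) z
      - \<phi> z * ln (\<eta> z)"
    unfolding v_def[abs_def] by blast
qed

end
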